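(* Let $A:X\to Y$ be a compact linear operator between Hilbert spaces, $y\in Y$, $\mathcal A:=A^*A$, $\mathbf y:=A^*y$, and let $\alpha_1,\alpha_2,\ldots$ be pairwise distinct positive reals. Assume that the Arnoldi method for the mixed rational Krylov space (defined in the context) does not break down up to index $N$, and let $q_1,\ldots,q_N$ be the vectors it produces. Then the matrix $$T_{i,j}:=\langle q_i,\mathcal A q_j\rangle,\qquad i,j=1,\ldots,N,$$ is pentadiagonal (that is, $T_{i,j}=0$ whenever $|i-j|>2$) and satisfies $$T_{m,2k}=0\quad\text{for } m=2k+2,\ldots,N,\qquad\qquad T_{m,2k+1}=0\quad\text{for } m=2k+4,\ldots,N,$$ for all integers $k$ for which the column index ($2k$, respectively $2k+1$) lies in $\{1,\ldots,N\}$.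
   Context: Arnoldi method: set $q_1:=\mathbf y/\|\mathbf y\|$ and, for $i=2,\ldots,N$, $$v_i:=\begin{cases}(\mathcal A+\alpha_kI)^{-1}q_{i-1}, & i=2k,\\ \mathcal A q_{i-1}, & i=2k+1,\end{cases}\qquad \tilde q_i:=v_i-\sum_{j=1}^{i-1}\langle v_i,q_j\rangle q_j,\qquad q_i:=\frac{\tilde q_i}{\|\tilde q_i\|}.$$ The method does not break down up to index $N$ if $\mathbf y\ne0$ and $\tilde q_i\neq 0$ for all $i=2,\ldots,N$, so that $q_1,\ldots,q_N$ are well defined. *)

theory Defs
  imports "HOL-Analysis.Analysis"
begin

section \<open>Hilbert spaces over the real or the complex numbers\<close>

text \<open>
  The library has inner product spaces over the reals only. To cover real and complex Hilbert
  spaces at once, the scalars are taken from a type \<open>'k\<close> of class \<^class>\<open>real_normed_field\<close>;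
  as the norm of such a field is multiplicative, it is isomorphic to the reals or to the complex
  numbers (Gelfand-Mazur). The conjugate of \<open>c\<close> is determined by \<open>conj c * c = |c|\<^sup>2\<close>,
  which is used as its definition.
\<close>

definition conjugate :: "'k::real_normed_field \<Rightarrow> 'k"
  where "conjugate c = of_real ((norm c)\<^sup>2) / c"

lemma conjugate_real: "conjugate (c::real) = c"
  by (simp add: conjugate_def power2_eq_square)

lemma conjugate_complex: "conjugate (c::complex) = cnj c"
proof (cases "c = 0")
  case False
  then show ?thesis
    unfolding conjugate_def by (simp only: complex_norm_square) simp
qed (simp add: conjugate_def)

text \<open>
  Inner products are linear in the first argument. The topology and the completeness of the space
  come from the class \<^class>\<open>banach\<close>; the last two assumptions say that the scalar multiplication
  extends the one by reals and that the norm is the one induced by the inner product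
  (so the inner product is positive definite).
\<close>

locale hilbert_space = vector_space smul
  for smul :: "'k::real_normed_field \<Rightarrow> 'a::banach \<Rightarrow> 'a" +
  fixes ip :: "'a \<Rightarrow> 'a \<Rightarrow> 'k"
  assumes ip_add_left: "ip (x + y) z = ip x z + ip y z"
    and ip_add_right: "ip x (y + z) = ip x y + ip x z"
    and ip_scale_left: "ip (smul c x) y = c * ip x y"
    and ip_commute: "ip y x = conjugate (ip x y)"
    and scale_of_real: "smul (of_real r) x = r *\<^sub>R x"
    and ip_same: "ip x x = of_real ((norm x)\<^sup>2)"

lemma hilbert_space_real:
  "hilbert_space scaleR (inner :: 'a::{real_inner, banach} \<Rightarrow> 'a \<Rightarrow> real)"
  by unfold_locales
    (simp_all add: algebra_simps inner_add_left inner_add_right conjugate_real inner_commute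
      power2_norm_eq_inner)

lemma hilbert_space_complex: "hilbert_space (*) (\<lambda>x y :: complex. x * cnj y)"
  by unfold_locales
    (simp_all add: algebra_simps conjugate_complex scaleR_conv_of_real flip: complex_norm_square)


section \<open>Compact operators, adjoints and resolvents\<close>

definition compact_operator ::
    "('k::real_normed_field \<Rightarrow> 'a::banach \<Rightarrow> 'a) \<Rightarrow> ('k \<Rightarrow> 'b::banach \<Rightarrow> 'b) \<Rightarrow> ('a \<Rightarrow> 'b) \<Rightarrow> bool"
  where "compact_operator scaleX scaleY A \<longleftrightarrow>
    Vector_Spaces.linear scaleX scaleY A \<and> (\<forall>S. bounded S \<longrightarrow> compact (closure (A ` S)))"

text \<open>The analogue of the constant \<^const>\<open>adjoint\<close> of the library for general scalars.\<close>

definition hilbert_adjoint ::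
    "('a \<Rightarrow> 'a \<Rightarrow> 'k) \<Rightarrow> ('b \<Rightarrow> 'b \<Rightarrow> 'k) \<Rightarrow> ('a \<Rightarrow> 'b) \<Rightarrow> 'b \<Rightarrow> 'a"
  where "hilbert_adjoint ipX ipY A = (SOME A'. \<forall>x y. ipY (A x) y = ipX x (A' y))"

definition shifted_inverse :: "('a::real_vector \<Rightarrow> 'a) \<Rightarrow> real \<Rightarrow> 'a \<Rightarrow> 'a"
  where "shifted_inverse B a = inv (\<lambda>u. B u + a *\<^sub>R u)"


section \<open>The Arnoldi method for the mixed rational Krylov space\<close>

definition arnoldi_step :: "('a::real_vector \<Rightarrow> 'a) \<Rightarrow> (nat \<Rightarrow> real) \<Rightarrow> nat \<Rightarrow> 'a \<Rightarrow> 'a"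
  where "arnoldi_step B \<alpha> i u = (if even i then shifted_inverse B (\<alpha> (i div 2)) u else B u)"

text \<open>
  The vectors are indexed from 1 on; the value at index 0 is a dummy. In case of a breakdown,
  \<open>arnoldi\<close> continues with the zero vector.
\<close>

fun arnoldi ::
    "('k \<Rightarrow> 'a \<Rightarrow> 'a) \<Rightarrow> ('a \<Rightarrow> 'a \<Rightarrow> 'k) \<Rightarrow> ('a::real_normed_vector \<Rightarrow> 'a) \<Rightarrow> (nat \<Rightarrow> real) \<Rightarrow> 'a
      \<Rightarrow> nat \<Rightarrow> 'a"
  where
    "arnoldi smul ip B \<alpha> b 0 = 0"
  | "arnoldi smul ip B \<alpha> b (Suc 0) = b /\<^sub>R norm b"
  | "arnoldi smul ip B \<alpha> b (Suc (Suc n)) =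
      (let v = arnoldi_step B \<alpha> (Suc (Suc n)) (arnoldi smul ip B \<alpha> b (Suc n));
           w = v - (\<Sum>j=1..Suc n. smul (ip v (arnoldi smul ip B \<alpha> b j)) (arnoldi smul ip B \<alpha> b j))
       in w /\<^sub>R norm w)"

definition arnoldi_v ::
    "('k \<Rightarrow> 'a \<Rightarrow> 'a) \<Rightarrow> ('a \<Rightarrow> 'a \<Rightarrow> 'k) \<Rightarrow> ('a::real_normed_vector \<Rightarrow> 'a) \<Rightarrow> (nat \<Rightarrow> real) \<Rightarrow> 'a
      \<Rightarrow> nat \<Rightarrow> 'a"
  where "arnoldi_v smul ip B \<alpha> b i = arnoldi_step B \<alpha> i (arnoldi smul ip B \<alpha> b (i - 1))"

definition arnoldi_tilde ::
    "('k \<Rightarrow> 'a \<Rightarrow> 'a) \<Rightarrow> ('a \<Rightarrow> 'a \<Rightarrow> 'k) \<Rightarrow> ('a::real_normed_vector \<Rightarrow> 'a) \<Rightarrow> (nat \<Rightarrow> real) \<Rightarrow> 'a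
      \<Rightarrow> nat \<Rightarrow> 'a"
  where "arnoldi_tilde smul ip B \<alpha> b i =
    arnoldi_v smul ip B \<alpha> b i -
    (\<Sum>j=1..i-1. smul (ip (arnoldi_v smul ip B \<alpha> b i) (arnoldi smul ip B \<alpha> b j))
                   (arnoldi smul ip B \<alpha> b j))"

lemma arnoldi_eq_normalized_tilde:
  assumes "i \<ge> 2"
  shows "arnoldi smul ip B \<alpha> b i =
    arnoldi_tilde smul ip B \<alpha> b i /\<^sub>R norm (arnoldi_tilde smul ip B \<alpha> b i)"
proof -
  obtain n where "i = Suc (Suc n)"
    using assms by (metis add_2_eq_Suc le_Suc_ex)
  then show ?thesis
    by (simp only: arnoldi_tilde_def arnoldi_v_def Let_def arnoldi.simps(3) diff_Suc_1)
qed

definition arnoldi_no_breakdown ::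
    "('k \<Rightarrow> 'a \<Rightarrow> 'a) \<Rightarrow> ('a \<Rightarrow> 'a \<Rightarrow> 'k) \<Rightarrow> ('a::real_normed_vector \<Rightarrow> 'a) \<Rightarrow> (nat \<Rightarrow> real) \<Rightarrow> 'a
      \<Rightarrow> nat \<Rightarrow> bool"
  where "arnoldi_no_breakdown smul ip B \<alpha> b N \<longleftrightarrow>
    b \<noteq> 0 \<and> (\<forall>i\<in>{2..N}. arnoldi_tilde smul ip B \<alpha> b i \<noteq> 0)"

definition pentadiagonal :: "nat \<Rightarrow> (nat \<Rightarrow> nat \<Rightarrow> 'k::zero) \<Rightarrow> bool"
  where "pentadiagonal N T \<longleftrightarrow>
    (\<forall>i\<in>{1..N}. \<forall>j\<in>{1..N}. \<bar>int i - int j\<bar> > 2 \<longrightarrow> T i j = 0)"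

end

theory Submission
  imports Defs
begin

text \<open>
  Let \<open>B = A\<^sup>* A\<close>, let \<open>b = A\<^sup>* y\<close>, and let \<open>R\<^sub>k\<close> be the inverse of \<open>B + \<alpha>\<^sub>k\<close>. The vectors
  \<open>B\<^sup>j R\<^sub>k \<dots> R\<^sub>1 b\<close> with \<open>k = n div 2\<close> and \<open>j < n\<close> span a space \<open>K\<^sub>n\<close>, consisting of the fractions
  with numerator of degree less than \<open>n\<close> and denominator \<open>(B + \<alpha>\<^sub>1) \<dots> (B + \<alpha>\<^sub>k)\<close>, applied to \<open>b\<close>.
  Counting degrees shows that these spaces increase with \<open>n\<close>, that \<open>R\<^sub>k\<^sub>+\<^sub>1\<close> maps \<open>K\<^sub>2\<^sub>k\<^sub>+\<^sub>1\<close> into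
  \<open>K\<^sub>2\<^sub>k\<^sub>+\<^sub>2\<close>, and that \<open>B\<close> maps \<open>K\<^sub>2\<^sub>k\<close> into \<open>K\<^sub>2\<^sub>k\<^sub>+\<^sub>1\<close> and \<open>K\<^sub>2\<^sub>k\<^sub>+\<^sub>1\<close> into \<open>K\<^sub>2\<^sub>k\<^sub>+\<^sub>3\<close>. Hence
  \<open>q\<^sub>n\<close> lies in \<open>K\<^sub>n\<close>. For \<open>n \<le> N\<close> the vectors \<open>q\<^sub>1, \<dots>, q\<^sub>n\<close> are orthonormal and \<open>K\<^sub>n\<close> has \<open>n\<close>
  generators, so they form a basis of \<open>K\<^sub>n\<close> (\<open>krylov_subset_span_arnoldi\<close>), and \<open>q\<^sub>m\<close> is orthogonal
  to \<open>K\<^sub>n\<close> for \<open>n < m \<le> N\<close>.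

  Applied to \<open>B q\<^sub>2\<^sub>k \<in> K\<^sub>2\<^sub>k\<^sub>+\<^sub>1\<close> and \<open>B q\<^sub>2\<^sub>k\<^sub>+\<^sub>1 \<in> K\<^sub>2\<^sub>k\<^sub>+\<^sub>3\<close>, this gives the two families of zeros. They
  contain all entries that are more than two places below the diagonal; the entries above it follow
  since \<open>B\<close> is symmetric.

  This rests on two facts about Hilbert spaces: the adjoint of \<open>A\<close> exists, by the Riesz
  representation theorem (\<open>riesz_representation\<close>), and \<open>B + \<alpha>\<^sub>k\<close> is bijective
  (\<open>bij_shifted_operator\<close>), by Banach's fixed point theorem. The conjugation on the abstract scalar
  field enters only through its multiplicativity and \<open>c * conjugate c = |c|\<^sup>2\<close>.
\<close>

section \<open>Inner products with general scalars\<close>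

lemma conjugate_mult: "conjugate (c * d) = conjugate c * conjugate d"
  by (simp add: conjugate_def norm_mult power_mult_distrib)

lemma mult_conjugate: "c * conjugate c = of_real ((norm c)\<^sup>2)"
  by (simp add: conjugate_def)

lemma conjugate_of_real: "conjugate (of_real r) = of_real r"
  by (simp add: conjugate_def power2_eq_square)

context hilbert_space
begin

lemma ip_scale_right: "ip x (smul c y) = conjugate c * ip x y"
  by (metis ip_commute ip_scale_left conjugate_mult)

lemma ip_zero_left: "ip 0 y = 0"
  using ip_add_left[of 0 0 y] by simp

lemma ip_zero_right: "ip x 0 = 0"
  using ip_add_right[of x 0 0] by simp

lemma ip_diff_left: "ip (x - y) z = ip x z - ip y z"
  using ip_add_left[of "x - y" y z] by simp

lemma ip_diff_right: "ip x (y - z) = ip x y - ip x z"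
  using ip_add_right[of x "y - z" z] by simp

lemma ip_scaleR_left: "ip (r *\<^sub>R x) y = of_real r * ip x y"
  by (metis scale_of_real ip_scale_left)

lemma ip_scaleR_right: "ip x (r *\<^sub>R y) = of_real r * ip x y"
  by (metis scale_of_real ip_scale_right conjugate_of_real)

lemma ip_sum_left: "ip (sum f I) z = (\<Sum>i\<in>I. ip (f i) z)"
  by (induction I rule: infinite_finite_induct) (simp_all add: ip_zero_left ip_add_left)

lemma ip_eq_0_commute: "ip x y = 0 \<longleftrightarrow> ip y x = 0"
  by (metis ip_commute conjugate_def div_0 norm_zero of_real_0 power2_eq_square mult_zero_left)

lemma ip_eqI:
  assumes "\<And>x. ip x u = ip x w"
  shows "u = w"
proof -
  have "ip (u - w) (u - w) = 0"
    using assms by (simp add: ip_diff_right)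
  then show ?thesis by (simp add: ip_same)
qed

lemma parallelogram:
  fixes x y :: 'a
  shows "(norm (x + y))\<^sup>2 + (norm (x - y))\<^sup>2 = 2 * (norm x)\<^sup>2 + 2 * (norm y)\<^sup>2"
proof -
  have "ip (x + y) (x + y) + ip (x - y) (x - y) = 2 * ip x x + 2 * ip y y"
    by (simp add: ip_add_left ip_add_right ip_diff_left ip_diff_right algebra_simps)
  then have "(of_real ((norm (x + y))\<^sup>2 + (norm (x - y))\<^sup>2) :: 'k)
      = of_real (2 * (norm x)\<^sup>2 + 2 * (norm y)\<^sup>2)"
    by (simp add: ip_same)
  then show ?thesis by (simp only: of_real_eq_iff)
qed

text \<open>
  Pythagoras for the component of \<open>x\<close> orthogonal to \<open>y\<close>. It gives both the Cauchy-Schwarz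
  inequality and the orthogonality of elements of minimal norm.
\<close>

lemma norm_orthogonal_component:
  assumes "y \<noteq> 0"
  shows "(norm (x - smul (ip x y / of_real ((norm y)\<^sup>2)) y))\<^sup>2
    = (norm x)\<^sup>2 - (norm (ip x y))\<^sup>2 / (norm y)\<^sup>2"
proof -
  define s :: 'k where "s = of_real ((norm y)\<^sup>2)"
  define c where "c = ip x y / s"
  have s: "s \<noteq> 0" "ip y y = s" using assms by (auto simp: s_def ip_same)
  have "ip (x - smul c y) y = 0"
    using s by (simp add: ip_diff_left ip_scale_left c_def)
  then have "ip (x - smul c y) (x - smul c y) = ip (x - smul c y) x"
    by (simp add: ip_diff_right ip_scale_right)
  also have "\<dots> = ip x x - ip x y * conjugate (ip x y) / s"
    by (simp add: ip_diff_left ip_scale_left c_def flip: ip_commute)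
  also have "\<dots> = of_real ((norm x)\<^sup>2 - (norm (ip x y))\<^sup>2 / (norm y)\<^sup>2)"
    by (simp add: mult_conjugate s_def ip_same)
  finally have "(of_real ((norm (x - smul c y))\<^sup>2) :: 'k)
      = of_real ((norm x)\<^sup>2 - (norm (ip x y))\<^sup>2 / (norm y)\<^sup>2)"
    by (simp only: ip_same)
  then show ?thesis unfolding of_real_eq_iff c_def s_def .
qed

lemma cauchy_schwarz: "norm (ip x y) \<le> norm x * norm y"
proof (cases "y = 0")
  case False
  have "0 \<le> (norm x)\<^sup>2 - (norm (ip x y))\<^sup>2 / (norm y)\<^sup>2"
    unfolding norm_orthogonal_component[OF False, symmetric] by simp
  then have "(norm (ip x y))\<^sup>2 \<le> (norm x * norm y)\<^sup>2"
    using False by (simp add: field_simps power_mult_distrib)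
  then show ?thesis by (rule power2_le_imp_le) simp
qed (simp add: ip_zero_right)


section \<open>The Riesz representation theorem\<close>

text \<open>
  A functional that is not zero is represented by a multiple of the element of minimal norm in
  the closed convex set where it takes the value 1.
\<close>

theorem riesz_representation:
  assumes add: "\<And>x y. f (x + y) = f x + f y"
    and scale: "\<And>c x. f (smul c x) = c * f x"
    and bound: "\<And>x. norm (f x) \<le> norm x * C"
  shows "\<exists>z. \<forall>x. f x = ip x z"
proof (cases "\<forall>x. f x = 0")
  case True
  then show ?thesis by (auto intro!: exI[of _ 0] simp: ip_zero_right)
next
  case False
  then obtain x0 where x0: "f x0 \<noteq> 0" by blast
  have scaleR: "f (r *\<^sub>R x) = r *\<^sub>R f x" for r x
    by (metis scale scale_of_real scaleR_conv_of_real)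
  interpret f: bounded_linear f
    by (rule bounded_linear_intro[where K = C]) (auto simp: add scaleR bound)
  define S where "S = {x. f x = 1}"
  define d where "d = (INF x\<in>S. (norm x)\<^sup>2)"
  have "smul (1 / f x0) x0 \<in> S" using x0 by (simp add: S_def scale)
  then have S_ne: "S \<noteq> {}" by blast
  have bdd: "bdd_below ((\<lambda>x. (norm x)\<^sup>2) ` S)"
    by (intro bdd_belowI[of _ 0]) auto
  have d_le: "d \<le> (norm x)\<^sup>2" if "x \<in> S" for x
    unfolding d_def by (rule cINF_lower[OF bdd that])
  have "\<exists>x\<in>S. (norm x)\<^sup>2 < d + 1 / real (Suc n)" for n
    using cINF_less_iff[OF S_ne bdd, of "d + 1 / real (Suc n)"] by (simp add: d_def)
  then obtain X where X: "\<And>n. X n \<in> S" "\<And>n. (norm (X n))\<^sup>2 < d + 1 / real (Suc n)"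
    by metis
  have near: "(norm (x - y))\<^sup>2 \<le> 4 * e"
    if "x \<in> S" "y \<in> S" "(norm x)\<^sup>2 \<le> d + e" "(norm y)\<^sup>2 \<le> d + e" for x y e
  proof -
    \<comment> \<open>the midpoint of \<open>x\<close> and \<open>y\<close> lies in \<open>S\<close> again\<close>
    have "f ((1/2) *\<^sub>R (x + y)) = (1/2) *\<^sub>R (1 + 1)"
      using that(1,2) by (simp only: scaleR add S_def mem_Collect_eq)
    also have "\<dots> = 1" by (simp add: scaleR_conv_of_real)
    finally have "(1/2) *\<^sub>R (x + y) \<in> S" by (simp add: S_def)
    from d_le[OF this] have "4 * d \<le> (norm (x + y))\<^sup>2"
      by (simp add: power_divide)
    then show ?thesis using parallelogram[of x y] that(3,4) by linarith
  qed
  have "Cauchy X"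
  proof (rule metric_CauchyI)
    fix e :: real assume e: "0 < e"
    then obtain M where M: "inverse (real (Suc M)) < e\<^sup>2 / 4"
      using reals_Archimedean[of "e\<^sup>2 / 4"] by auto
    have "dist (X m) (X n) < e" if "m \<ge> M" "n \<ge> M" for m n
    proof -
      have le: "(norm (X i))\<^sup>2 \<le> d + 1 / real (Suc M)" if "i \<ge> M" for i
        using X(2)[of i] that frac_le[of 1 1 "real (Suc M)" "real (Suc i)"] by simp
      have "(norm (X m - X n))\<^sup>2 \<le> 4 * (1 / real (Suc M))"
        by (intro near X(1) le that)
      also have "\<dots> < e\<^sup>2" using M by (simp add: field_simps)
      finally show ?thesis using e by (simp add: dist_norm power2_less_imp_less)
    qed
    then show "\<exists>M. \<forall>m\<ge>M. \<forall>n\<ge>M. dist (X m) (X n) < e" by blast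
  qed
  then obtain z where z: "X \<longlonglongrightarrow> z"
    using Cauchy_convergent convergentD by blast
  have "(\<lambda>n. f (X n)) \<longlonglongrightarrow> f z" by (rule f.tendsto[OF z])
  moreover have "(\<lambda>n. f (X n)) = (\<lambda>n. 1)" using X(1) by (auto simp: S_def)
  ultimately have fz: "f z = 1" by (simp add: LIMSEQ_const_iff)
  have "(\<lambda>n. d + 1 / real (Suc n)) \<longlonglongrightarrow> d + 0"
    by (intro tendsto_add tendsto_const) (use LIMSEQ_inverse_real_of_nat in \<open>simp add: divide_inverse\<close>)
  then have z_le: "(norm z)\<^sup>2 \<le> d"
    by (intro LIMSEQ_le[of "\<lambda>n. (norm (X n))\<^sup>2" _ "\<lambda>n. d + 1 / real (Suc n)"]
        tendsto_power tendsto_norm z) (use X(2) less_imp_le in auto)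
  have orth: "ip z w = 0" if "f w = 0" for w
  proof (cases "w = 0")
    case False
    have "z - smul c w \<in> S" for c
      using fz that by (simp add: S_def f.diff scale)
    from z_le order_trans[OF z_le d_le[OF this]]
    have "(norm z)\<^sup>2 \<le> (norm z)\<^sup>2 - (norm (ip z w))\<^sup>2 / (norm w)\<^sup>2"
      unfolding norm_orthogonal_component[OF False, symmetric] by blast
    then have "(norm (ip z w))\<^sup>2 / (norm w)\<^sup>2 \<le> 0" by simp
    then show ?thesis using False by (simp add: divide_le_0_iff)
  qed (simp add: ip_zero_right)
  have z0: "z \<noteq> 0" using fz f.zero by force
  have "f x = ip x (inverse ((norm z)\<^sup>2) *\<^sub>R z)" for x
  proof -
    have "f (x - smul (f x) z) = 0" using fz by (simp add: f.diff scale)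
    then have "ip (x - smul (f x) z) z = 0" using orth ip_eq_0_commute by blast
    then have "ip x z = f x * of_real ((norm z)\<^sup>2)"
      by (simp add: ip_diff_left ip_scale_left ip_same)
    then show ?thesis using z0 by (simp add: ip_scaleR_right)
  qed
  then show ?thesis by blast
qed

end

section \<open>The operator A* A and its resolvents\<close>

lemma compact_operator_bounded:
  assumes X: "hilbert_space scaleX ipX" and Y: "hilbert_space scaleY ipY"
    and A: "compact_operator scaleX scaleY A"
  obtains K where "K \<ge> 0" "\<And>x. norm (A x) \<le> K * norm x"
proof -
  interpret X: hilbert_space scaleX ipX by (fact X)
  interpret Y: hilbert_space scaleY ipY by (fact Y)
  interpret A: Vector_Spaces.linear scaleX scaleY A
    using A by (simp add: compact_operator_def)
  have scaleR: "A (r *\<^sub>R x) = r *\<^sub>R A x" for r x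
    by (metis A.scale X.scale_of_real Y.scale_of_real)
  have "compact (closure (A ` cball 0 1))"
    using A bounded_cball unfolding compact_operator_def by blast
  from bounded_subset[OF compact_imp_bounded[OF this] closure_subset]
  have "bounded (A ` cball 0 1)" .
  then obtain K where K: "K > 0" "\<And>x. norm x \<le> 1 \<Longrightarrow> norm (A x) \<le> K"
    unfolding bounded_pos by auto
  have "norm (A x) \<le> K * norm x" for x
  proof (cases "x = 0")
    case False
    then have "norm (A (inverse (norm x) *\<^sub>R x)) \<le> K" by (intro K(2)) simp
    then show ?thesis using False by (simp add: scaleR field_simps)
  qed (simp add: A.zero)
  with K(1) show ?thesis by (intro that[of K]) auto
qed

lemma hilbert_adjoint_works:
  assumes X: "hilbert_space scaleX ipX" and Y: "hilbert_space scaleY ipY"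
    and A: "compact_operator scaleX scaleY A"
  shows "ipY (A x) y = ipX x (hilbert_adjoint ipX ipY A y)"
proof -
  interpret X: hilbert_space scaleX ipX by (fact X)
  interpret Y: hilbert_space scaleY ipY by (fact Y)
  interpret A: Vector_Spaces.linear scaleX scaleY A
    using A by (simp add: compact_operator_def)
  obtain K where K: "K \<ge> 0" "\<And>x. norm (A x) \<le> K * norm x"
    using compact_operator_bounded[OF X Y A] by blast
  have "\<exists>z. \<forall>x. ipY (A x) y = ipX x z" for y
  proof (rule X.riesz_representation)
    fix x
    have "norm (ipY (A x) y) \<le> norm (A x) * norm y" by (rule Y.cauchy_schwarz)
    also have "\<dots> \<le> (K * norm x) * norm y" by (intro mult_right_mono K(2)) simp
    finally show "norm (ipY (A x) y) \<le> norm x * (K * norm y)" by (simp add: ac_simps)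
  qed (simp_all add: A.add A.scale Y.ip_add_left Y.ip_scale_left)
  then have "\<exists>A'. \<forall>x y. ipY (A x) y = ipX x (A' y)" by metis
  from someI_ex[OF this] show ?thesis unfolding hilbert_adjoint_def by blast
qed

text \<open>
  With a bound \<open>\<kappa>\<close> on the square of the norm of the operator \<open>A\<close>, the map
  \<open>x \<mapsto> x - (B x + a x - u) / (a + \<kappa>)\<close> contracts distances by the factor \<open>\<kappa> / (a + \<kappa>)\<close>. Its
  fixed points are the solutions of \<open>B x + a x = u\<close>. The hypotheses are the ones that
  \<open>B = A\<^sup>* A\<close> satisfies with \<open>p x = (norm (A x))\<^sup>2\<close>.
\<close>

lemma (in hilbert_space) bij_shifted_operator:
  assumes add: "\<And>x y. B (x + y) = B x + B y"
    and p: "\<And>x. ip x (B x) = of_real (p x)" "\<And>x. p x \<ge> 0"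
    and bound: "\<And>x. (norm (B x))\<^sup>2 \<le> \<kappa> * p x"
    and \<kappa>: "\<kappa> \<ge> 0" and a: "a > 0"
  shows "bij (\<lambda>x. B x + a *\<^sub>R x)"
proof (rule bijI')
  define r where "r = 1 / (a + \<kappa>)"
  define s where "s = \<kappa> / (a + \<kappa>)"
  have r: "r > 0" and s: "s \<ge> 0" "s < 1" and sr: "1 - r * a = s" "r * \<kappa> = s"
    using \<kappa> a by (auto simp: r_def s_def field_simps)
  have diff: "B (x - y) = B x - B y" for x y
    using add[of "x - y" y] by simp
  have contr: "norm (s *\<^sub>R x - r *\<^sub>R B x) \<le> s * norm x" for x
  proof -
    have p': "ip (B x) x = of_real (p x)"
      by (metis p(1) ip_commute conjugate_of_real)
    have "(of_real ((norm (s *\<^sub>R x - r *\<^sub>R B x))\<^sup>2) :: 'k)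
        = of_real (s\<^sup>2 * (norm x)\<^sup>2 - 2 * s * r * p x + r\<^sup>2 * (norm (B x))\<^sup>2)"
      unfolding ip_same[symmetric] ip_diff_left ip_diff_right ip_scaleR_left ip_scaleR_right p p'
      by (simp add: ip_same algebra_simps power2_eq_square)
    then have "(norm (s *\<^sub>R x - r *\<^sub>R B x))\<^sup>2
        = s\<^sup>2 * (norm x)\<^sup>2 - 2 * s * r * p x + r\<^sup>2 * (norm (B x))\<^sup>2"
      by (simp only: of_real_eq_iff)
    also have "\<dots> \<le> s\<^sup>2 * (norm x)\<^sup>2 - 2 * s * r * p x + r\<^sup>2 * (\<kappa> * p x)"
      by (intro add_left_mono mult_left_mono bound) simp
    also have "r\<^sup>2 * (\<kappa> * p x) = s * r * p x"
      by (simp add: power2_eq_square flip: sr(2))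
    also have "s\<^sup>2 * (norm x)\<^sup>2 - 2 * s * r * p x + s * r * p x \<le> (s * norm x)\<^sup>2"
      using s r p(2)[of x] by (simp add: power_mult_distrib)
    finally show ?thesis by (rule power2_le_imp_le) (use s in simp)
  qed
  have solve: "\<exists>!x. x - r *\<^sub>R (B x + a *\<^sub>R x - u) = x" for u
  proof (rule banach_fix_type[OF s])
    show "\<forall>x y. dist (x - r *\<^sub>R (B x + a *\<^sub>R x - u)) (y - r *\<^sub>R (B y + a *\<^sub>R y - u)) \<le> s * dist x y"
    proof (intro allI)
      fix x y
      have "x - r *\<^sub>R (B x + a *\<^sub>R x - u) - (y - r *\<^sub>R (B y + a *\<^sub>R y - u))
          = s *\<^sub>R (x - y) - r *\<^sub>R B (x - y)"
        by (simp add: diff algebra_simps flip: sr(1))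
      then show "dist (x - r *\<^sub>R (B x + a *\<^sub>R x - u)) (y - r *\<^sub>R (B y + a *\<^sub>R y - u)) \<le> s * dist x y"
        using contr[of "x - y"] by (simp add: dist_norm)
    qed
  qed
  have solve_iff: "x - r *\<^sub>R (B x + a *\<^sub>R x - u) = x \<longleftrightarrow> B x + a *\<^sub>R x = u" for x u
    using r by auto
  show "B x + a *\<^sub>R x = B y + a *\<^sub>R y \<longleftrightarrow> x = y" for x y
    using solve[of "B y + a *\<^sub>R y"] unfolding solve_iff by blast
  show "\<exists>x. u = B x + a *\<^sub>R x" for u
    using solve[of u] unfolding solve_iff by metis
qed

section \<open>The Arnoldi vectors and the mixed rational Krylov spaces\<close>

text \<open>
  An Arnoldi method without breakdown up to index \<open>N\<close>, for any symmetric operator \<open>B\<close> whose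
  shifts by the parameters are invertible.
\<close>

locale arnoldi_process = hilbert_space smul ip
  for smul :: "'k::real_normed_field \<Rightarrow> 'a::banach \<Rightarrow> 'a" and ip +
  fixes B :: "'a \<Rightarrow> 'a" and \<alpha> :: "nat \<Rightarrow> real" and b :: 'a and N :: nat
  assumes B_add: "B (x + y) = B x + B y"
    and B_scale: "B (smul c x) = smul c (B x)"
    and B_symmetric: "ip (B x) y = ip x (B y)"
    and bij_shift: "k \<ge> 1 \<Longrightarrow> bij (\<lambda>x. B x + \<alpha> k *\<^sub>R x)"
    and no_breakdown: "arnoldi_no_breakdown smul ip B \<alpha> b N"
begin

abbreviation q where "q \<equiv> arnoldi smul ip B \<alpha> b"

abbreviation R where "R k \<equiv> shifted_inverse B (\<alpha> k)"

lemma B_scaleR: "B (r *\<^sub>R x) = r *\<^sub>R B x"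
  by (metis B_scale scale_of_real)

lemma shift_R: "k \<ge> 1 \<Longrightarrow> B (R k x) + \<alpha> k *\<^sub>R R k x = x"
  unfolding shifted_inverse_def using surj_f_inv_f[OF bij_is_surj[OF bij_shift[of k]], of x] .

lemma R_eqI: "k \<ge> 1 \<Longrightarrow> B z + \<alpha> k *\<^sub>R z = x \<Longrightarrow> R k x = z"
  unfolding shifted_inverse_def using inv_f_f[OF bij_is_inj[OF bij_shift[of k]], of z] by simp

lemma R_add: "k \<ge> 1 \<Longrightarrow> R k (x + y) = R k x + R k y"
  by (rule R_eqI) (use shift_R[of k x] shift_R[of k y] in \<open>auto simp: B_add algebra_simps\<close>)

lemma R_scale: "k \<ge> 1 \<Longrightarrow> R k (smul c x) = smul c (R k x)"
proof (rule R_eqI)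
  assume "k \<ge> 1"
  then have "smul c (B (R k x) + \<alpha> k *\<^sub>R R k x) = smul c x" by (simp only: shift_R)
  then show "B (smul c (R k x)) + \<alpha> k *\<^sub>R smul c (R k x) = smul c x"
    by (simp add: scale_right_distrib B_scale mult.commute flip: scale_of_real)
qed

lemma R_B: "k \<ge> 1 \<Longrightarrow> R k (B x) = B (R k x)"
proof (rule R_eqI)
  assume "k \<ge> 1"
  then have "B (B (R k x) + \<alpha> k *\<^sub>R R k x) = B x" by (simp only: shift_R)
  then show "B (B (R k x)) + \<alpha> k *\<^sub>R B (R k x) = B x" by (simp add: B_add B_scaleR)
qed

lemma B_funpow_add: "(B ^^ j) (x + y) = (B ^^ j) x + (B ^^ j) y"
  by (induction j) (simp_all add: B_add)

lemma B_funpow_scale: "(B ^^ j) (smul c x) = smul c ((B ^^ j) x)"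
  by (induction j) (simp_all add: B_scale)

lemma R_B_funpow: "k \<ge> 1 \<Longrightarrow> R k ((B ^^ j) x) = (B ^^ j) (R k x)"
  by (induction j) (simp_all add: R_B)

lemma linear_image_span:
  assumes add: "\<And>x y. f (x + y) = f x + f y" and scale: "\<And>c x. f (smul c x) = smul c (f x)"
    and gen: "\<And>g. g \<in> G \<Longrightarrow> f g \<in> span H"
    and x: "x \<in> span G"
  shows "f x \<in> span H"
  using x
proof (induction rule: span_induct)
  case base
  have "f 0 = 0" using scale[of 0 0] by simp
  then show ?case
    by (auto simp: subspace_def add scale span_zero span_add span_scale)
qed (fact gen)

text \<open>The vector \<open>R\<^sub>k \<dots> R\<^sub>1 b\<close>, that is, \<open>b\<close> divided by \<open>(B + \<alpha>\<^sub>1) \<dots> (B + \<alpha>\<^sub>k)\<close>.\<close>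

primrec resolvent_product :: "nat \<Rightarrow> 'a" where
  "resolvent_product 0 = b"
| "resolvent_product (Suc k) = R (Suc k) (resolvent_product k)"

text \<open>
  The mixed rational Krylov space of index \<open>n\<close> is spanned by the vectors \<open>B\<^sup>j R\<^sub>k \<dots> R\<^sub>1 b\<close> with
  \<open>j < n\<close>, where \<open>k = n div 2\<close>. All its elements have the common denominator
  \<open>(B + \<alpha>\<^sub>1) \<dots> (B + \<alpha>\<^sub>k)\<close> and a numerator of degree less than \<open>n\<close>, which makes
  counting degrees simpler than a partial fraction expansion would.
\<close>

definition krylov_gens :: "nat \<Rightarrow> 'a set" where
  "krylov_gens n = (\<lambda>j. (B ^^ j) (resolvent_product (n div 2))) ` {..<n}"

definition krylov :: "nat \<Rightarrow> 'a set" where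
  "krylov n = span (krylov_gens n)"

lemma krylov_base: "j < n \<Longrightarrow> n div 2 = k \<Longrightarrow> (B ^^ j) (resolvent_product k) \<in> krylov n"
  by (auto simp: krylov_def krylov_gens_def intro: span_base)

lemma krylov_image:
  assumes "\<And>x y. f (x + y) = f x + f y" "\<And>c x. f (smul c x) = smul c (f x)"
    and "\<And>j. j < n \<Longrightarrow> f ((B ^^ j) (resolvent_product (n div 2))) \<in> krylov m"
    and "x \<in> krylov n"
  shows "f x \<in> krylov m"
  unfolding krylov_def
proof (rule linear_image_span[OF assms(1,2)])
  show "f g \<in> span (krylov_gens m)" if "g \<in> krylov_gens n" for g
    using that assms(3) unfolding krylov_gens_def[of n] krylov_def by blast
  show "x \<in> span (krylov_gens n)" using assms(4) unfolding krylov_def .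
qed

text \<open>
  Extending the fraction \<open>B\<^sup>j / ((B + \<alpha>\<^sub>1) \<dots> (B + \<alpha>\<^sub>k))\<close> by \<open>B + \<alpha>\<^sub>k\<^sub>+\<^sub>1\<close> raises the degree of the
  numerator by one.
\<close>

lemma B_funpow_resolvent_product:
  "(B ^^ j) (resolvent_product k) = (B ^^ Suc j) (resolvent_product (Suc k))
    + smul (of_real (\<alpha> (Suc k))) ((B ^^ j) (resolvent_product (Suc k)))"
proof -
  have "resolvent_product k = B (resolvent_product (Suc k))
      + smul (of_real (\<alpha> (Suc k))) (resolvent_product (Suc k))"
    using shift_R[of "Suc k" "resolvent_product k"] by (simp add: scale_of_real)
  then have "(B ^^ j) (resolvent_product k) = (B ^^ j) (B (resolvent_product (Suc k))
      + smul (of_real (\<alpha> (Suc k))) (resolvent_product (Suc k)))" by simp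
  then show ?thesis by (simp only: B_funpow_add B_funpow_scale funpow_Suc_right o_apply)
qed

lemma krylov_base_Suc:
  assumes "Suc j < n" "n div 2 = Suc k"
  shows "(B ^^ j) (resolvent_product k) \<in> krylov n"
proof -
  have "(B ^^ Suc j) (resolvent_product (Suc k)) \<in> krylov n"
    "(B ^^ j) (resolvent_product (Suc k)) \<in> krylov n"
    using assms by (auto intro: krylov_base simp del: funpow.simps resolvent_product.simps)
  then show ?thesis
    unfolding B_funpow_resolvent_product[of j k] krylov_def by (intro span_add span_scale)
qed

lemma krylov_Suc: "x \<in> krylov n \<Longrightarrow> x \<in> krylov (Suc n)"
proof (rule krylov_image[where f = "\<lambda>x. x"])
  fix j assume j: "j < n"
  show "(B ^^ j) (resolvent_product (n div 2)) \<in> krylov (Suc n)"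
  proof (cases "even n")
    case True
    then show ?thesis by (intro krylov_base) (use j in auto)
  next
    case False
    then show ?thesis by (intro krylov_base_Suc) (use j in auto)
  qed
qed (rule refl | assumption)+

lemma krylov_mono: "n \<le> m \<Longrightarrow> x \<in> krylov n \<Longrightarrow> x \<in> krylov m"
  by (induction rule: dec_induct) (assumption, rule krylov_Suc)

lemma B_krylov_even: "x \<in> krylov (2 * k) \<Longrightarrow> B x \<in> krylov (2 * k + 1)"
proof (rule krylov_image[OF B_add B_scale])
  fix j assume "j < 2 * k"
  then have "(B ^^ Suc j) (resolvent_product k) \<in> krylov (2 * k + 1)"
    by (intro krylov_base) simp_all
  then show "B ((B ^^ j) (resolvent_product (2 * k div 2))) \<in> krylov (2 * k + 1)"
    by simp
qed

lemma B_krylov_odd: "x \<in> krylov (2 * k + 1) \<Longrightarrow> B x \<in> krylov (2 * k + 3)"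
proof (rule krylov_image[OF B_add B_scale])
  fix j assume "j < 2 * k + 1"
  then have "(B ^^ Suc j) (resolvent_product k) \<in> krylov (2 * k + 3)"
    by (intro krylov_base_Suc) linarith+
  then show "B ((B ^^ j) (resolvent_product ((2 * k + 1) div 2))) \<in> krylov (2 * k + 3)"
    by simp
qed

lemma R_krylov: "x \<in> krylov (2 * k + 1) \<Longrightarrow> R (Suc k) x \<in> krylov (2 * k + 2)"
proof (rule krylov_image[where f = "R (Suc k)"])
  fix j assume "j < 2 * k + 1"
  then have "(B ^^ j) (resolvent_product (Suc k)) \<in> krylov (2 * k + 2)"
    by (intro krylov_base) auto
  moreover have "R (Suc k) ((B ^^ j) (resolvent_product k)) = (B ^^ j) (resolvent_product (Suc k))"
    using R_B_funpow[of "Suc k" j "resolvent_product k"] by simp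
  ultimately show "R (Suc k) ((B ^^ j) (resolvent_product ((2 * k + 1) div 2))) \<in> krylov (2 * k + 2)"
    by simp
qed (simp_all add: R_add R_scale)

lemma arnoldi_v_krylov:
  assumes "n \<ge> 2" "q (n - 1) \<in> krylov (n - 1)"
  shows "arnoldi_v smul ip B \<alpha> b n \<in> krylov n"
proof (cases "even n")
  case True
  with assms(1) obtain l where "n = 2 * l" "l \<noteq> 0" by (auto elim: evenE)
  then obtain k where "n = 2 * k + 2" by (cases l) auto
  with assms(2) show ?thesis using R_krylov[of "q (n - 1)" k]
    by (simp add: arnoldi_v_def arnoldi_step_def)
next
  case False
  then obtain k where "n = 2 * k + 1" by (rule oddE)
  with assms(2) show ?thesis using B_krylov_even[of "q (n - 1)" k]
    by (simp add: arnoldi_v_def arnoldi_step_def)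
qed

lemma arnoldi_krylov: "n \<ge> 1 \<Longrightarrow> q n \<in> krylov n"
proof (induction n rule: less_induct)
  case (less n)
  show ?case
  proof (cases "n = 1")
    case True
    have "smul (of_real (inverse (norm b))) b \<in> krylov 1"
      using krylov_base[of 0 1 0] by (simp add: krylov_def span_scale)
    then show ?thesis unfolding scale_of_real using True by simp
  next
    case False
    with less.prems have n: "n \<ge> 2" by simp
    have qj: "q j \<in> krylov n" if "j \<in> {1..n-1}" for j
      using that n less.IH[of j] krylov_mono[of j n "q j"] by auto
    have "arnoldi_v smul ip B \<alpha> b n \<in> krylov n"
      using n less.IH[of "n - 1"] by (intro arnoldi_v_krylov) auto
    then have "arnoldi_tilde smul ip B \<alpha> b n \<in> krylov n"
      using qj unfolding arnoldi_tilde_def krylov_def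
      by (intro span_diff span_sum span_scale) auto
    then show ?thesis
      unfolding arnoldi_eq_normalized_tilde[OF n] krylov_def scale_of_real[symmetric]
      by (rule span_scale)
  qed
qed

lemma arnoldi_normalized:
  assumes "n \<in> {1..N}"
  shows "ip (q n) (q n) = 1"
proof -
  have "norm (q n) = 1"
  proof (cases "n = 1")
    case True
    then show ?thesis using no_breakdown by (simp add: arnoldi_no_breakdown_def)
  next
    case False
    with assms have n: "n \<ge> 2" by simp
    with assms have "arnoldi_tilde smul ip B \<alpha> b n \<noteq> 0"
      using no_breakdown by (simp add: arnoldi_no_breakdown_def)
    then show ?thesis unfolding arnoldi_eq_normalized_tilde[OF n] by simp
  qed
  then show ?thesis by (simp add: ip_same)
qed

lemma arnoldi_orthogonal_less: "1 \<le> j \<Longrightarrow> j < n \<Longrightarrow> n \<le> N \<Longrightarrow> ip (q n) (q j) = 0"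
proof (induction n arbitrary: j rule: less_induct)
  case (less n)
  define v where "v = arnoldi_v smul ip B \<alpha> b n"
  have orth: "ip (q l) (q j) = (if l = j then 1 else 0)" if l: "l \<in> {1..n-1}" for l
  proof -
    consider "l < j" | "l = j" | "j < l" by linarith
    then show ?thesis
    proof cases
      case 1
      then have "ip (q j) (q l) = 0" using less.IH[of j l] less.prems l by auto
      then show ?thesis using 1 ip_eq_0_commute by auto
    next
      case 2
      then show ?thesis using arnoldi_normalized[of j] less.prems by auto
    next
      case 3
      then show ?thesis using less.IH[of l j] less.prems l by auto
    qed
  qed
  have "ip (arnoldi_tilde smul ip B \<alpha> b n) (q j)
      = ip v (q j) - (\<Sum>l=1..n-1. ip v (q l) * ip (q l) (q j))"
    by (simp add: arnoldi_tilde_def v_def ip_diff_left ip_sum_left ip_scale_left)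
  also have "(\<Sum>l=1..n-1. ip v (q l) * ip (q l) (q j))
      = (\<Sum>l=1..n-1. if l = j then ip v (q l) else 0)"
    by (intro sum.cong refl) (simp add: orth)
  also have "\<dots> = ip v (q j)" using less.prems by (simp add: sum.delta')
  finally have "ip (arnoldi_tilde smul ip B \<alpha> b n) (q j) = 0" by simp
  moreover have "n \<ge> 2" using less.prems by simp
  ultimately show ?case
    by (simp add: arnoldi_eq_normalized_tilde ip_scaleR_left)
qed

lemma arnoldi_orthogonal: "i \<in> {1..N} \<Longrightarrow> j \<in> {1..N} \<Longrightarrow> i \<noteq> j \<Longrightarrow> ip (q i) (q j) = 0"
  using arnoldi_orthogonal_less[of i j] arnoldi_orthogonal_less[of j i] ip_eq_0_commute
  by (cases "i < j") auto

lemma arnoldi_inj: "inj_on q {1..N}"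
proof (rule inj_onI, rule ccontr)
  fix i j assume "i \<in> {1..N}" "j \<in> {1..N}" "q i = q j" "i \<noteq> j"
  then show False using arnoldi_orthogonal[of i j] arnoldi_normalized[of i] by simp
qed

lemma orthogonal_span:
  assumes "\<And>g. g \<in> G \<Longrightarrow> ip g w = 0" "x \<in> span G"
  shows "ip x w = 0"
  using assms(2)
proof (induction rule: span_induct)
  case base
  then show ?case by (auto simp: subspace_def ip_zero_left ip_add_left ip_scale_left)
qed (fact assms(1))

lemma arnoldi_independent:
  assumes "n \<le> N"
  shows "independent (q ` {1..n})"
proof
  assume "dependent (q ` {1..n})"
  then obtain i where i: "i \<in> {1..n}" "q i \<in> span (q ` {1..n} - {q i})"
    unfolding dependent_def by blast
  have "ip (q i) (q i) = 0"
  proof (rule orthogonal_span[OF _ i(2)])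
    fix g assume "g \<in> q ` {1..n} - {q i}"
    then obtain j where "j \<in> {1..n}" "g = q j" "j \<noteq> i" by blast
    then show "ip g (q i) = 0" using i(1) assms by (auto intro: arnoldi_orthogonal)
  qed
  then show False using arnoldi_normalized[of i] i(1) assms by simp
qed

text \<open>
  The space of index \<open>n\<close> has \<open>n\<close> generators and contains the \<open>n\<close> independent vectors
  \<open>q 1, \<dots>, q n\<close>, so these span it.
\<close>

lemma krylov_subset_span_arnoldi:
  assumes "n \<le> N"
  shows "krylov n \<subseteq> span (q ` {1..n})"
proof (rule subsetI, rule ccontr)
  fix x assume x: "x \<in> krylov n" "x \<notin> span (q ` {1..n})"
  have "independent (insert x (q ` {1..n}))"
    using x(2) arnoldi_independent[OF assms] by (rule independent_insertI)
  moreover have "insert x (q ` {1..n}) \<subseteq> span (krylov_gens n)"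
    using x(1) arnoldi_krylov krylov_mono[of _ n] by (auto simp flip: krylov_def)
  ultimately have "card (insert x (q ` {1..n})) \<le> card (krylov_gens n)"
    using independent_span_bound[of "krylov_gens n"] by (simp add: krylov_gens_def)
  also have "\<dots> \<le> n"
    using card_image_le[of "{..<n}"] by (auto simp: krylov_gens_def)
  finally have "card (insert x (q ` {1..n})) \<le> n" .
  moreover have "x \<notin> q ` {1..n}" using x(2) span_base by blast
  moreover have "card (q ` {1..n}) = n"
    using card_image[OF inj_on_subset[OF arnoldi_inj, of "{1..n}"]] assms by simp
  ultimately show False by simp
qed

lemma arnoldi_orthogonal_krylov:
  assumes "n < m" "m \<le> N" "x \<in> krylov n"
  shows "ip (q m) x = 0"
proof -
  have "ip x (q m) = 0"
  proof (rule orthogonal_span)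
    show "x \<in> span (q ` {1..n})"
      using krylov_subset_span_arnoldi[of n] assms by auto
  qed (use assms in \<open>auto intro!: arnoldi_orthogonal\<close>)
  then show ?thesis using ip_eq_0_commute by blast
qed


section \<open>The zero pattern\<close>

lemma arnoldi_matrix_even_column:
  assumes "k \<ge> 1" "2 * k + 2 \<le> m" "m \<le> N"
  shows "ip (q m) (B (q (2 * k))) = 0"
  using assms arnoldi_orthogonal_krylov[OF _ _ B_krylov_even[OF arnoldi_krylov[of "2 * k"]], of m]
  by simp

lemma arnoldi_matrix_odd_column:
  assumes "2 * k + 4 \<le> m" "m \<le> N"
  shows "ip (q m) (B (q (2 * k + 1))) = 0"
  using assms arnoldi_orthogonal_krylov[OF _ _ B_krylov_odd[OF arnoldi_krylov[of "2 * k + 1"]], of m]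
  by simp

lemma arnoldi_matrix_below:
  assumes "1 \<le> j" "j + 2 < i" "i \<le> N"
  shows "ip (q i) (B (q j)) = 0"
proof (cases "even j")
  case True
  then obtain k where "j = 2 * k" by (rule evenE)
  with assms show ?thesis using arnoldi_matrix_even_column[of k i] by simp
next
  case False
  then obtain k where "j = 2 * k + 1" by (rule oddE)
  with assms show ?thesis using arnoldi_matrix_odd_column[of k i] by simp
qed

lemma arnoldi_matrix_pentadiagonal: "pentadiagonal N (\<lambda>i j. ip (q i) (B (q j)))"
  unfolding pentadiagonal_def
proof (intro ballI impI)
  fix i j assume ij: "i \<in> {1..N}" "j \<in> {1..N}" "\<bar>int i - int j\<bar> > 2"
  show "ip (q i) (B (q j)) = 0"
  proof (cases "j < i")
    case True
    then show ?thesis using ij by (intro arnoldi_matrix_below) auto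
  next
    case False
    then have "ip (q j) (B (q i)) = 0" using ij by (intro arnoldi_matrix_below) auto
    \<comment> \<open>the matrix is Hermitian\<close>
    then show ?thesis using ip_eq_0_commute B_symmetric by metis
  qed
qed

end

lemma arnoldi_process_compact_operator:
  fixes scaleX :: "'k::real_normed_field \<Rightarrow> 'a::banach \<Rightarrow> 'a"
    and scaleY :: "'k \<Rightarrow> 'b::banach \<Rightarrow> 'b"
  assumes X: "hilbert_space scaleX ipX" and Y: "hilbert_space scaleY ipY"
    and A: "compact_operator scaleX scaleY A"
    and \<alpha>: "\<And>k. k \<ge> 1 \<Longrightarrow> \<alpha> k > 0"
    and nb: "arnoldi_no_breakdown scaleX ipX (hilbert_adjoint ipX ipY A \<circ> A) \<alpha> b N"
  shows "arnoldi_process scaleX ipX (hilbert_adjoint ipX ipY A \<circ> A) \<alpha> b N"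
proof -
  interpret X: hilbert_space scaleX ipX by (fact X)
  interpret Y: hilbert_space scaleY ipY by (fact Y)
  interpret A: Vector_Spaces.linear scaleX scaleY A
    using A by (simp add: compact_operator_def)
  define B where "B = hilbert_adjoint ipX ipY A \<circ> A"
  have ip_B: "ipX x (B y) = ipY (A x) (A y)" for x y
    by (simp add: B_def flip: hilbert_adjoint_works[OF X Y A])
  have B_add: "B (x + y) = B x + B y" for x y
    by (rule X.ip_eqI) (simp add: ip_B X.ip_add_right Y.ip_add_right A.add)
  obtain K where K: "K \<ge> 0" "\<And>x. norm (A x) \<le> K * norm x"
    using compact_operator_bounded[OF X Y A] by blast
  have B_bound: "norm (B x) \<le> K * norm (A x)" for x
  proof (cases "B x = 0")
    case False
    have "(norm (B x))\<^sup>2 = norm (ipX (B x) (B x))" by (simp add: X.ip_same norm_power)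
    also have "\<dots> = norm (ipY (A (B x)) (A x))" by (simp only: ip_B)
    also have "\<dots> \<le> norm (A (B x)) * norm (A x)" by (rule Y.cauchy_schwarz)
    also have "\<dots> \<le> (K * norm (B x)) * norm (A x)" by (intro mult_right_mono K(2)) simp
    finally show ?thesis using False by (simp add: power2_eq_square)
  qed (simp add: K(1))
  show ?thesis
    unfolding B_def[symmetric]
  proof unfold_locales
    show "B (x + y) = B x + B y" for x y by (fact B_add)
    show "B (scaleX c x) = scaleX c (B x)" for c x
      by (rule X.ip_eqI) (simp add: ip_B X.ip_scale_right Y.ip_scale_right A.scale)
    show "ipX (B x) y = ipX x (B y)" for x y
      by (metis ip_B X.ip_commute Y.ip_commute)
    show "bij (\<lambda>x. B x + \<alpha> k *\<^sub>R x)" if "k \<ge> 1" for k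
    proof (rule X.bij_shifted_operator[where p = "\<lambda>x. (norm (A x))\<^sup>2" and \<kappa> = "K\<^sup>2"])
      show "(norm (B x))\<^sup>2 \<le> K\<^sup>2 * (norm (A x))\<^sup>2" for x
        using power_mono[OF B_bound, of x 2] by (simp add: power_mult_distrib)
    qed (use \<alpha>[OF that] in \<open>simp_all add: B_add ip_B Y.ip_same\<close>)
    show "arnoldi_no_breakdown scaleX ipX B \<alpha> b N" using nb by (simp add: B_def)
  qed
qed

theorem theorem2:
  fixes scaleX :: "'k::real_normed_field \<Rightarrow> 'a::banach \<Rightarrow> 'a"
    and ipX :: "'a \<Rightarrow> 'a \<Rightarrow> 'k"
    and scaleY :: "'k \<Rightarrow> 'b::banach \<Rightarrow> 'b"
    and ipY :: "'b \<Rightarrow> 'b \<Rightarrow> 'k"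
    and A :: "'a \<Rightarrow> 'b"
    and y :: 'b
    and \<alpha> :: "nat \<Rightarrow> real"
    and N :: nat
  defines "Astar \<equiv> hilbert_adjoint ipX ipY A"
  defines "B \<equiv> Astar \<circ> A"
  defines "q \<equiv> arnoldi scaleX ipX B \<alpha> (Astar y)"
  defines "T \<equiv> \<lambda>i j. ipX (q i) (B (q j))"
  assumes X: "hilbert_space scaleX ipX"
    and Y: "hilbert_space scaleY ipY"
    and A: "compact_operator scaleX scaleY A"
    and \<alpha>_pos: "\<And>k. k \<ge> 1 \<Longrightarrow> \<alpha> k > 0"
    and \<alpha>_distinct: "inj_on \<alpha> {1..}"
    and no_breakdown: "arnoldi_no_breakdown scaleX ipX B \<alpha> (Astar y) N"
  shows "pentadiagonal N T
    \<and> (\<forall>k. 2 * k \<in> {1..N} \<longrightarrow> (\<forall>m\<in>{2 * k + 2..N}. T m (2 * k) = 0))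
    \<and> (\<forall>k. 2 * k + 1 \<in> {1..N} \<longrightarrow> (\<forall>m\<in>{2 * k + 4..N}. T m (2 * k + 1) = 0))"
proof -
  interpret arnoldi_process scaleX ipX B \<alpha> "Astar y" N
    using no_breakdown unfolding B_def Astar_def
    by (intro arnoldi_process_compact_operator[OF X Y A] \<alpha>_pos)
  show ?thesis
    unfolding T_def q_def
    using arnoldi_matrix_pentadiagonal arnoldi_matrix_even_column arnoldi_matrix_odd_column
    by auto
qed

end
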